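(* Let $\mathbf{M}$ be a 2-point-homogeneous space with associated function $\tau$, set of values $T=\{\tau(x,y):x,y\in\mathbf{M}\}$ and $\tau_0=\tau(x,x)$. Assume that its zonal spherical functions $\Phi_k(t)=p_{k0}+p_{k1}t+\dots+p_{kk}t^k$ are polynomials of degree $k$ with $\Phi_k(\tau_0)=1$, and write $\Phi=\{\Phi_k(t)\}_{k=0,1,\dots}$. Let $S=T\cap[a,b]$. For a natural number $m$, consider the following semidefinite problem ($SDP_0$) in the real variables $y,x_1,\dots,x_{2m-1}$: minimize $y$ subject to $$y+\sum_{i=1}^{k}p_{ki}x_i\ \ge\ -p_{k0}\qquad (k=1,\dots,2m-1),\qquad \bar H_m(x_1,\dots,x_{2m-1},[a,b])\succeq 0 .$$ If $y^*$ is the optimal solution of the $SDP_0$ problem, then $$A(\mathbf{M},S)\ \le\ SDP_0(\Phi,[a,b],m):=\frac{1+y^*}{y^*}.$$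
   Context: **2-point-homogeneous space.** A metric space $\mathbf{M}$ with distance $\rho$, on which a group $G$ acts so that $\rho$ is strongly invariant under $G$: for $x,x',y,y'\in\mathbf{M}$ with $\rho(x,y)=\rho(x',y')$ there is $g\in G$ with $g(x)=x'$ and $g(y)=y'$. With $\mathbf{M}$ is associated a certain function $\tau(x,y)=F(\rho(x,y))$ of the distance. For example, $\tau(x,y)=\langle x,y\rangle=\cos\rho(x,y)$ for the unit sphere with angular distance $\rho$, and $\tau=\rho$ for the Hamming space with Hamming distance. Put $\tau_0=\tau(x,x)$. **Zonal spherical functions.** With $\mathbf{M}$ and each integer $k\ge0$ is associated the zonal spherical function $\Phi_k(t)$. The functions $\Phi_0,\Phi_1,\Phi_2,\dots$ are orthogonal on $T$ and normalized by $\Phi_k(\tau_0)=1$, so $\Phi_0=1$. For every finite set $\{x_i\}\subset\mathbf{M}$ and every $k$, the matrix $(\Phi_k(\tau(x_i,x_j)))$ is positive semidefinite. For the unit sphere $\mathbb{S}^{n-1}$ they are the Gegenbauer polynomials $G_k^{(n)}$ normalized by $G_k^{(n)}(1)=1$; for the binary Hamming space they are the Krawtchouk polynomials. **Codes.** For $S\subset T$, a finite subset $C\subset\mathbf{M}$ is an $S$-code if $\tau(x,y)\in S$ for all $x,y\in C$ with $x\ne y$. $A(\mathbf{M},S)$ denotes the largest cardinality of an $S$-code. **The matrix $\bar H_m$.** Put $x_0=1$. Then $\bar H_m(x_1,\dots,x_{2m-1},[a,b])$ is the $3m\times 3m$ block diagonal matrix with three $m\times m$ diagonal blocks $R$, $F^+$,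 $F^-$, whose entries for $0\le i,j\le m-1$ are $$R_{ij}=x_{i+j},\qquad F^+_{ij}=x_{i+j+1}-a\,x_{i+j},\qquad F^-_{ij}=b\,x_{i+j}-x_{i+j+1}.$$ The notation $X\succeq0$ means that the symmetric matrix $X$ is positive semidefinite.
   Formalization: The formal theorem additionally assumes y* > 0: at y* = 0 the bound (1+y* )/y* is undefined, and for y* < 0 it is below 1 and the claim fails (e.g. unit sphere with [a,b] = [-1,1], where y* = -1). *)

theory Defs
  imports
    "HOL-Analysis.Analysis"
    "HOL-Algebra.Group_Action"
    "HOL-Computational_Algebra.Polynomial"
    "Jordan_Normal_Form.Matrix"
begin

(* JNF and HOL-Analysis share several names and symbols, hence the qualified constants. *)

definition psd_mat :: "real Matrix.mat \<Rightarrow> bool" where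
  "psd_mat A \<longleftrightarrow>
     square_mat A \<and> Matrix.transpose_mat A = A \<and>
     (\<forall>v \<in> carrier_vec (dim_row A). 0 \<le> scalar_prod v (mult_mat_vec A v))"

(* Strong invariance is exactly the two-point transitivity below; that the group acts by
   isometries is deliberately not required, so that case is included. *)
definition two_point_homogeneous ::
  "('g, 'h) monoid_scheme \<Rightarrow> 'a set \<Rightarrow> ('g \<Rightarrow> 'a \<Rightarrow> 'a) \<Rightarrow> ('a \<Rightarrow> 'a \<Rightarrow> real) \<Rightarrow> bool" where
  "two_point_homogeneous G M act \<rho> \<longleftrightarrow>
     M \<noteq> {} \<and> Metric_space M \<rho> \<and> group_action G M act \<and>
     (\<forall>x\<in>M. \<forall>x'\<in>M. \<forall>y\<in>M. \<forall>y'\<in>M. \<rho> x y = \<rho> x' y' \<longrightarrow>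
        (\<exists>g\<in>carrier G. act g x = x' \<and> act g y = y'))"

definition value_set :: "'a set \<Rightarrow> ('a \<Rightarrow> 'a \<Rightarrow> real) \<Rightarrow> real set" where
  "value_set M \<tau> = {\<tau> x y | x y. x \<in> M \<and> y \<in> M}"

(* Orthogonality with respect to a positive finite measure w carried by T. A finite T
   carries only card T orthogonal functions of positive norm (the Krawtchouk polynomials
   of degree 0..n on {0..n} for the Hamming space), so for finite T orthogonality
   concerns the indices below card T; for infinite T it concerns all indices. *)
definition orthogonal_functions_on :: "real set \<Rightarrow> (nat \<Rightarrow> real \<Rightarrow> real) \<Rightarrow> bool" where
  "orthogonal_functions_on T \<phi> \<longleftrightarrow>
     (\<exists>w. finite_measure w \<and> sets w = sets borel \<and> (AE t in w. t \<in> T) \<and>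
        (\<forall>i j. (infinite T \<or> (i < card T \<and> j < card T)) \<longrightarrow>
           integrable w (\<lambda>t. \<phi> i t * \<phi> j t) \<and>
           (if i = j then (\<integral>t. \<phi> i t * \<phi> j t \<partial>w) > 0
            else (\<integral>t. \<phi> i t * \<phi> j t \<partial>w) = 0)))"

(* Zonal spherical functions enter through their characteristic properties: orthogonality
   on T, normalization at tau0, and positive semidefiniteness on M. *)
definition zonal_spherical_functions ::
  "'a set \<Rightarrow> ('a \<Rightarrow> 'a \<Rightarrow> real) \<Rightarrow> real \<Rightarrow> (nat \<Rightarrow> real \<Rightarrow> real) \<Rightarrow> bool" where
  "zonal_spherical_functions M \<tau> \<tau>0 \<phi> \<longleftrightarrow>
     orthogonal_functions_on (value_set M \<tau>) \<phi> \<and>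
     (\<forall>k. \<phi> k \<tau>0 = 1) \<and>
     (\<forall>t\<in>value_set M \<tau>. \<phi> 0 t = 1) \<and>
     (\<forall>k xs. distinct xs \<and> set xs \<subseteq> M \<longrightarrow>
        psd_mat (Matrix.mat (length xs) (length xs) (\<lambda>(i, j). \<phi> k (\<tau> (xs ! i) (xs ! j)))))"

definition is_code :: "'a set \<Rightarrow> ('a \<Rightarrow> 'a \<Rightarrow> real) \<Rightarrow> real set \<Rightarrow> 'a set \<Rightarrow> bool" where
  "is_code M \<tau> S C \<longleftrightarrow>
     finite C \<and> C \<subseteq> M \<and> (\<forall>x\<in>C. \<forall>y\<in>C. x \<noteq> y \<longrightarrow> \<tau> x y \<in> S)"

(* Infinite when the cardinalities of codes are unbounded. *)
definition max_code_size :: "'a set \<Rightarrow> ('a \<Rightarrow> 'a \<Rightarrow> real) \<Rightarrow> real set \<Rightarrow> enat" where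
  "max_code_size M \<tau> S = (SUP C \<in> {C. is_code M \<tau> S C}. enat (card C))"

(* The variables x_1, x_2, ... together with the convention x_0 = 1. *)
definition ext_var :: "(nat \<Rightarrow> real) \<Rightarrow> nat \<Rightarrow> real" where
  "ext_var x i = (if i = 0 then 1 else x i)"

definition H_bar :: "nat \<Rightarrow> (nat \<Rightarrow> real) \<Rightarrow> real \<Rightarrow> real \<Rightarrow> real Matrix.mat" where
  "H_bar m x a b = diag_block_mat
     [Matrix.mat m m (\<lambda>(i, j). ext_var x (i + j)),
      Matrix.mat m m (\<lambda>(i, j). ext_var x (i + j + 1) - a * ext_var x (i + j)),
      Matrix.mat m m (\<lambda>(i, j). b * ext_var x (i + j) - ext_var x (i + j + 1))]"

definition sdp0_feasible ::
  "(nat \<Rightarrow> real poly) \<Rightarrow> real \<Rightarrow> real \<Rightarrow> nat \<Rightarrow> real \<Rightarrow> (nat \<Rightarrow> real) \<Rightarrow> bool" where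
  "sdp0_feasible \<Phi> a b m y x \<longleftrightarrow>
     (\<forall>k\<in>{1..2*m-1}. y + (\<Sum>i=1..k. coeff (\<Phi> k) i * x i) \<ge> - coeff (\<Phi> k) 0) \<and>
     psd_mat (H_bar m x a b)"

definition sdp0_optimal ::
  "(nat \<Rightarrow> real poly) \<Rightarrow> real \<Rightarrow> real \<Rightarrow> nat \<Rightarrow> real \<Rightarrow> bool" where
  "sdp0_optimal \<Phi> a b m ystar \<longleftrightarrow>
     (\<exists>x. sdp0_feasible \<Phi> a b m ystar x) \<and>
     (\<forall>y x. sdp0_feasible \<Phi> a b m y x \<longrightarrow> ystar \<le> y)"

end

theory Submission
  imports Defs
begin

text \<open>
  For a code of cardinality \<open>N \<ge> 2\<close>, let \<open>x\<^sub>i\<close> be the average of \<open>\<tau>(p, q)\<^sup>i\<close> over the ordered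
  pairs of distinct codewords. These are the moments of a probability measure on \<open>[a, b]\<close>, so the
  three Hankel blocks are positive semidefinite. The entries of the matrix of the values of
  \<open>\<Phi>\<^sub>k\<close> have nonnegative sum, and the diagonal contributes \<open>N\<close> to it; dividing by \<open>N (N - 1)\<close>
  shows that \<open>(1 / (N - 1), x)\<close> is feasible. Hence \<open>y\<^sup>* \<le> 1 / (N - 1)\<close>.
\<close>

lemma mat_quadratic_form:
  fixes f :: "nat \<times> nat \<Rightarrow> real"
  assumes "v \<in> carrier_vec n"
  shows "scalar_prod v (mult_mat_vec (Matrix.mat n n f) v) =
    (\<Sum>i<n. \<Sum>j<n. vec_index v i * f (i, j) * vec_index v j)"
  using assms
  by (auto simp: scalar_prod_def lessThan_atLeast0 sum_distrib_left mult.assoc intro!: sum.cong)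

text \<open>The sum of the entries is the value of the quadratic form at the all-ones
  vector.\<close>

lemma psd_mat_sum_entries_nonneg:
  fixes f :: "nat \<times> nat \<Rightarrow> real"
  assumes "psd_mat (Matrix.mat n n f)"
  shows "0 \<le> (\<Sum>i<n. \<Sum>j<n. f (i, j))"
proof -
  have "0 \<le> scalar_prod (Matrix.vec n (\<lambda>_. 1)) (mult_mat_vec (Matrix.mat n n f) (Matrix.vec n (\<lambda>_. 1)))"
    using assms by (auto simp: psd_mat_def)
  then show ?thesis
    by (simp add: mat_quadratic_form)
qed

text \<open>Splitting a vector as \<open>u @\<^sub>v w\<close> along the blocks leaves no cross
  terms, so the quadratic form is the sum of the forms of \<open>A\<close> at \<open>u\<close> and
  of \<open>B\<close> at \<open>w\<close>.\<close>

lemma psd_mat_four_block: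
  assumes A: "psd_mat A" and B: "psd_mat B"
  shows "psd_mat (four_block_mat A (0\<^sub>m (dim_row A) (dim_col B)) (0\<^sub>m (dim_row B) (dim_col A)) B)"
    (is "psd_mat ?M")
proof -
  define n k where "n = dim_row A" and "k = dim_row B"
  have cA: "A \<in> carrier_mat n n" and cB: "B \<in> carrier_mat k k"
    using A B by (auto simp: psd_mat_def n_def k_def)
  have dims: "dim_row A = n" "dim_col A = n" "dim_row B = k" "dim_col B = k"
    using cA cB by auto
  have M: "?M = four_block_mat A (0\<^sub>m n k) (0\<^sub>m k n) B"
    by (simp add: dims)
  have "Matrix.transpose_mat ?M = ?M"
    using A B unfolding M
    by (subst transpose_four_block_mat[OF cA _ _ cB]) (auto simp: psd_mat_def)
  moreover have "0 \<le> scalar_prod v (mult_mat_vec ?M v)" if "v \<in> carrier_vec (dim_row ?M)" for v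
  proof -
    define u w where "u = vec_first v n" and "w = vec_last v k"
    have v: "v \<in> carrier_vec (n + k)"
      using that by (simp add: dims)
    have u: "u \<in> carrier_vec n" and w: "w \<in> carrier_vec k"
      by (simp_all add: u_def w_def)
    have "v = u @\<^sub>v w"
      using v by (simp add: u_def w_def)
    moreover have "mult_mat_vec ?M (u @\<^sub>v w) = mult_mat_vec A u @\<^sub>v mult_mat_vec B w"
      unfolding M using cA cB u w
      by (subst four_block_mat_mult_vec[OF cA _ _ cB u w]) auto
    ultimately have "scalar_prod v (mult_mat_vec ?M v) =
        scalar_prod u (mult_mat_vec A u) + scalar_prod w (mult_mat_vec B w)"
      using cA cB u w by (simp add: scalar_prod_append[of _ n _ k])
    then show ?thesis
      using A B u w by (simp add: psd_mat_def dims)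
  qed
  ultimately show ?thesis
    by (auto simp: psd_mat_def dims)
qed

lemma psd_mat_diag_block_mat:
  assumes "\<And>A. A \<in> set As \<Longrightarrow> psd_mat A"
  shows "psd_mat (diag_block_mat As)"
  using assms
proof (induction As)
  case Nil
  show ?case
    by (auto simp: psd_mat_def scalar_prod_def)
next
  case (Cons A As)
  then show ?case
    by (simp add: Let_def psd_mat_four_block)
qed

text \<open>Reading \<open>v\<close> as the coefficients of a polynomial of degree below
  \<open>n\<close>, the quadratic form is the weighted sum of the squares of its values at the
  points \<open>t p\<close>.\<close>

lemma psd_mat_moment:
  fixes t w :: "'p \<Rightarrow> real"
  assumes "\<And>p. p \<in> P \<Longrightarrow> 0 \<le> w p"
  shows "psd_mat (Matrix.mat n n (\<lambda>(i, j). \<Sum>p\<in>P. w p * t p ^ (i + j)))"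
    (is "psd_mat ?A")
proof -
  have "0 \<le> scalar_prod v (mult_mat_vec ?A v)" if v: "v \<in> carrier_vec n" for v
  proof -
    have "scalar_prod v (mult_mat_vec ?A v) =
        (\<Sum>i<n. \<Sum>j<n. \<Sum>p\<in>P. w p * ((vec_index v i * t p ^ i) * (vec_index v j * t p ^ j)))"
      unfolding mat_quadratic_form[OF v]
      by (simp add: sum_distrib_left sum_distrib_right power_add mult_ac)
    also have "\<dots> = (\<Sum>p\<in>P. \<Sum>i<n. \<Sum>j<n. w p * ((vec_index v i * t p ^ i) * (vec_index v j * t p ^ j)))"
      by (simp add: sum.swap[of _ P])
    also have "\<dots> = (\<Sum>p\<in>P. w p * (\<Sum>i<n. vec_index v i * t p ^ i)\<^sup>2)"
      unfolding power2_eq_square sum_product by (simp add: sum_distrib_left)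
    also have "\<dots> \<ge> 0"
      using assms by (intro sum_nonneg mult_nonneg_nonneg) auto
    finally show ?thesis .
  qed
  then show ?thesis
    by (auto simp: psd_mat_def add.commute)
qed

text \<open>All three blocks are moment matrices over the same points: the first with weights
  \<open>w p\<close>, the other two with weights \<open>w p * (t p - a)\<close> and
  \<open>w p * (b - t p)\<close>, which are nonnegative because \<open>t p\<close> lies in
  \<open>{a..b}\<close>.\<close>

lemma psd_mat_H_bar_moments:
  fixes t w :: "'p \<Rightarrow> real"
  assumes w: "\<And>p. p \<in> P \<Longrightarrow> 0 \<le> w p" and w1: "sum w P = 1"
    and t: "\<And>p. p \<in> P \<Longrightarrow> t p \<in> {a..b}"
  shows "psd_mat (H_bar m (\<lambda>i. \<Sum>p\<in>P. w p * t p ^ i) a b)"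
proof -
  let ?x = "\<lambda>i. \<Sum>p\<in>P. w p * t p ^ i"
  \<comment> \<open>Total mass 1 makes the zeroth moment agree with the convention that
    \<open>x_0\<close> is 1.\<close>
  have ext: "ext_var ?x i = ?x i" for i
    using w1 by (simp add: ext_var_def)
  have "ext_var ?x (i + 1) - a * ext_var ?x i = (\<Sum>p\<in>P. (w p * (t p - a)) * t p ^ i)" for i
    unfolding ext by (simp add: sum_distrib_left sum_subtractf[symmetric] algebra_simps)
  moreover have "b * ext_var ?x i - ext_var ?x (i + 1) = (\<Sum>p\<in>P. (w p * (b - t p)) * t p ^ i)" for i
    unfolding ext by (simp add: sum_distrib_left sum_subtractf[symmetric] algebra_simps)
  ultimately show ?thesis
    unfolding H_bar_def using w t
    by (intro psd_mat_diag_block_mat) (auto simp: ext intro!: psd_mat_moment)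
qed

text \<open>Positive semidefiniteness is stated for enumerations by distinct lists; reindexing along
  such an enumeration of \<open>C\<close> turns the sum of the matrix entries into a sum over
  points.\<close>

lemma zonal_sum_nonneg:
  assumes "zonal_spherical_functions M \<tau> \<tau>0 \<phi>" "finite C" "C \<subseteq> M"
  shows "0 \<le> (\<Sum>p\<in>C. \<Sum>q\<in>C. \<phi> k (\<tau> p q))"
proof -
  obtain xs where xs: "set xs = C" "distinct xs"
    using assms(2) finite_distinct_list by blast
  have bij: "bij_betw ((!) xs) {..<length xs} C"
    using xs by (simp add: bij_betw_nth)
  have "0 \<le> (\<Sum>i<length xs. \<Sum>j<length xs. \<phi> k (\<tau> (xs ! i) (xs ! j)))"
    using assms(1,3) xs psd_mat_sum_entries_nonneg[of "length xs" "\<lambda>(i, j). \<phi> k (\<tau> (xs ! i) (xs ! j))"]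
    by (auto simp: zonal_spherical_functions_def)
  also have "\<dots> = (\<Sum>p\<in>C. \<Sum>q\<in>C. \<phi> k (\<tau> p q))"
    by (simp add: sum.reindex_bij_betw[OF bij, of "\<lambda>q. \<phi> k (\<tau> _ q)"]
        sum.reindex_bij_betw[OF bij, of "\<lambda>p. \<Sum>q\<in>C. \<phi> k (\<tau> p q)"])
  finally show ?thesis .
qed

lemma code_sdp0_feasible:
  assumes zonal: "zonal_spherical_functions M \<tau> \<tau>0 (\<lambda>k. poly (\<Phi> k))"
    and diag: "\<And>x. x \<in> M \<Longrightarrow> \<tau> x x = \<tau>0"
    and deg: "\<And>k. degree (\<Phi> k) = k"
    and code: "is_code M \<tau> S C" and S: "S \<subseteq> {a..b}" and card: "card C \<ge> 2"
  shows "\<exists>x. sdp0_feasible \<Phi> a b m (1 / (real (card C) - 1)) x"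
proof -
  define N where "N = real (card C)"
  define D where "D = Sigma C (\<lambda>p. C - {p})"
  define t where "t = (\<lambda>(p, q). \<tau> p q)"
  \<comment> \<open>The uniform weight on the N(N - 1) ordered pairs of distinct codewords in
    \<open>D\<close>.\<close>
  define w where "w = 1 / (N * (N - 1))"
  define x where "x = (\<lambda>i. \<Sum>d\<in>D. w * t d ^ i)"
  have C: "finite C" "C \<subseteq> M"
    using code by (auto simp: is_code_def)
  have N: "N \<ge> 2"
    using card by (simp add: N_def)
  have cardD: "real (card D) = N * (N - 1)"
    using C card unfolding D_def N_def
    by (subst card_SigmaI) (auto simp: of_nat_diff)
  have wD: "(\<Sum>d\<in>D. w) = 1"
    using N by (simp add: cardD w_def)
  have w0: "0 \<le> w"
    using N by (simp add: w_def)
  have tS: "t d \<in> S" if "d \<in> D" for d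
    using that code by (auto simp: D_def t_def is_code_def)
  have "psd_mat (H_bar m x a b)"
    unfolding x_def using S tS by (intro psd_mat_H_bar_moments[OF w0 wD]) blast
  moreover have "1 / (N - 1) + (\<Sum>i=1..k. coeff (\<Phi> k) i * x i) \<ge> - coeff (\<Phi> k) 0" for k
  proof -
    \<comment> \<open>Each diagonal term is the value of \<open>\<Phi> k\<close> at
      \<open>\<tau>0\<close>, that is 1.\<close>
    have "(\<Sum>p\<in>C. \<Sum>q\<in>C. poly (\<Phi> k) (\<tau> p q)) =
        (\<Sum>p\<in>C. 1 + (\<Sum>q\<in>C - {p}. poly (\<Phi> k) (\<tau> p q)))"
      using C diag zonal
      by (intro sum.cong) (auto simp: sum.remove[of C] zonal_spherical_functions_def)
    also have "\<dots> = N + (\<Sum>d\<in>D. poly (\<Phi> k) (t d))"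
      using C by (simp add: sum.distrib N_def D_def t_def sum.Sigma split_def)
    finally have "0 \<le> w * (N + (\<Sum>d\<in>D. poly (\<Phi> k) (t d)))"
      using zonal_sum_nonneg[OF zonal C, of k] w0 by simp
    \<comment> \<open>The diagonal total N becomes w N = 1 / (N - 1), which is the source of the
      value chosen for y.\<close>
    also have "\<dots> = 1 / (N - 1) + (\<Sum>d\<in>D. w * poly (\<Phi> k) (t d))"
      using N by (simp add: w_def sum_distrib_left distrib_left)
    \<comment> \<open>Expanding \<open>\<Phi> k\<close> in powers and exchanging the sums makes its
      average a linear form in the moments.\<close>
    also have "(\<Sum>d\<in>D. w * poly (\<Phi> k) (t d)) = (\<Sum>i\<le>k. coeff (\<Phi> k) i * x i)"
      by (simp add: poly_altdef deg x_def sum_distrib_left mult_ac sum.swap[of _ D])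
    \<comment> \<open>The term i = 0 is the bare constant coefficient because \<open>x 0\<close> is
      the total weight 1.\<close>
    also have "\<dots> = coeff (\<Phi> k) 0 + (\<Sum>i=1..k. coeff (\<Phi> k) i * x i)"
      using wD by (simp add: atMost_atLeast0 sum.atLeast_Suc_atMost x_def)
    finally show ?thesis
      by simp
  qed
  ultimately show ?thesis
    unfolding sdp0_feasible_def N_def by blast
qed

theorem theorem5p5:
  fixes G :: "('g, 'h) monoid_scheme" and act :: "'g \<Rightarrow> 'a \<Rightarrow> 'a"
    and M :: "'a set" and \<rho> :: "'a \<Rightarrow> 'a \<Rightarrow> real"
    and F :: "real \<Rightarrow> real" and \<tau> :: "'a \<Rightarrow> 'a \<Rightarrow> real" and \<tau>0 :: real
    and \<Phi> :: "nat \<Rightarrow> real poly"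
    and T S :: "real set" and a b ystar :: real and m :: nat
  assumes "two_point_homogeneous G M act \<rho>"
    and "\<And>x y. x \<in> M \<Longrightarrow> y \<in> M \<Longrightarrow> \<tau> x y = F (\<rho> x y)"
    and "\<And>x. x \<in> M \<Longrightarrow> \<tau> x x = \<tau>0"
    and "T = value_set M \<tau>"
    and "zonal_spherical_functions M \<tau> \<tau>0 (\<lambda>k. poly (\<Phi> k))"
    and "\<And>k. degree (\<Phi> k) = k"
    and "S = T \<inter> {a..b}"
    and "m \<ge> 1"
    and "sdp0_optimal \<Phi> a b m ystar"
    and "ystar > 0"
  shows "ereal_of_enat (max_code_size M \<tau> S) \<le> ereal ((1 + ystar) / ystar)"
proof -
  have bound: "real (card C) \<le> (1 + ystar) / ystar" if code: "is_code M \<tau> S C" for C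
  proof (cases "card C \<ge> 2")
    case True
    obtain x where "sdp0_feasible \<Phi> a b m (1 / (real (card C) - 1)) x"
      using code_sdp0_feasible[OF assms(5,3,6) code _ True] \<open>S = T \<inter> {a..b}\<close> by blast
    then have "ystar \<le> 1 / (real (card C) - 1)"
      using assms(9) by (auto simp: sdp0_optimal_def)
    \<comment> \<open>Since \<open>ystar\<close> is positive, inverting gives N - 1 \<le> 1 /
      \<open>ystar\<close>.\<close>
    then show ?thesis
      using True \<open>ystar > 0\<close> by (simp add: field_simps)
  next
    \<comment> \<open>With fewer than two codewords there are no pairs to average over, but the
      bound 1 + 1 / \<open>ystar\<close> already exceeds 1.\<close>
    case False
    then have "real (card C) \<le> 1"
      by simp
    also have "1 \<le> (1 + ystar) / ystar"
      using \<open>ystar > 0\<close> by simp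
    finally show ?thesis .
  qed
  \<comment> \<open>The supremum is taken in \<open>enat\<close>, so the real bound is first rounded
    down to a natural number; this loses nothing for cardinalities and also shows that the supremum
    is finite.\<close>
  define n where "n = nat \<lfloor>(1 + ystar) / ystar\<rfloor>"
  have "max_code_size M \<tau> S \<le> enat n"
    unfolding max_code_size_def n_def using bound by (auto intro!: SUP_least simp: le_nat_floor)
  then have "ereal_of_enat (max_code_size M \<tau> S) \<le> ereal_of_enat (enat n)"
    by (simp only: ereal_of_enat_le_iff)
  also have "\<dots> \<le> ereal ((1 + ystar) / ystar)"
    using \<open>ystar > 0\<close> by (simp add: n_def)
  finally show ?thesis .
qed

end
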